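(* Let $\mathcal D$ be any probability distribution on $\mathcal X\times\{-1,1\}$, let $\mathbf p\in\mathbb R^n$, and let $Q=\mathcal N(\mathbf p,I)$ be the Gaussian distribution on $\mathbb R^n$ with mean $\mathbf p$ and identity covariance. Then for all $(\mathbf x,y)\in\mathcal X\times\{-1,1\}$, $$\mathbb E_{\mathbf w\sim\mathcal N(\mathbf p,I)}\,\ell(\mathbf h_{\mathbf w}(\mathbf x),y)=\Phi\left(y\,\frac{\mathbf p\cdot\mathbf f(\mathbf x)}{\|\mathbf f(\mathbf x)\|}\right),$$ and $$c_{\mathcal D}^{\mathcal N(\mathbf p,I)}(\mathbf h_{\mathbf p})=1-\mathbb E_{(\mathbf x,y)\sim\mathcal D}\left[\Phi\left(\frac{|\mathbf p\cdot\mathbf f(\mathbf x)|}{\|\mathbf f(\mathbf x)\|}\right)\,\Big|\,y\,\mathbf p\cdot\mathbf f(\mathbf x)\le0\right],$$ $$b_{\mathcal D}^{\mathcal N(\mathbf p,I)}(\mathbf h_{\mathbf p})=\mathbb E_{(\mathbf x,y)\sim\mathcal D}\left[\Phi\left(\frac{|\mathbf p\cdot\mathbf f(\mathbf x)|}{\|\mathbf f(\mathbf x)\|}\right)\,\Big|\,y\,\mathbf p\cdot\mathbf f(\mathbf x)>0\right],$$ each of the latter two whenever the conditioning event has positive probability, where $\Phi(k)=\frac12\big(1-\mathrm{erf}(k/\sqrt2)\big)$ and $\mathrm{erf}(k)=\frac{2}{\sqrt\pi}\int_0^k e^{-t^2}\,dt$.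
   Context: Labels are $\mathcal Y=\{-1,1\}$; $f_1,\dots,f_n:\mathcal X\to\{-1,1\}$ are fixed base classifiers (measurable), $\mathbf f(\mathbf x)=(f_1(\mathbf x),\dots,f_n(\mathbf x))$, $\|\cdot\|$ is the Euclidean norm. For $\mathbf w\in\mathbb R^n$, $\mathbf h_{\mathbf w}(\mathbf x)=\mathbf w\cdot\mathbf f(\mathbf x)$ is the weighted majority vote, with loss $$\ell(\mathbf h_{\mathbf w}(\mathbf x),y)=\mathbb 1\Big\{y\ne\arg\max_{\hat y\in\{-1,1\}}\sum_{j=1}^n w_j\mathbb 1\{f_j(\mathbf x)=\hat y\}\Big\},$$ where ties count as errors; equivalently $\ell(\mathbf h_{\mathbf w}(\mathbf x),y)=\mathbb 1\{y\,\mathbf w\cdot\mathbf f(\mathbf x)\le0\}$. For a distribution $Q$ on weight vectors, $$b_{\mathcal D}^Q(\mathbf h_{\mathbf p})=\mathbb E_{(\mathbf x,y)\sim\mathcal D}\Big[\mathbb E_{\mathbf w\sim Q}\,\ell(\mathbf h_{\mathbf w}(\mathbf x),y)\,\Big|\,\ell(\mathbf h_{\mathbf p}(\mathbf x),y)=0\Big],\qquad c_{\mathcal D}^Q(\mathbf h_{\mathbf p})=\mathbb E_{(\mathbf x,y)\sim\mathcal D}\Big[\mathbb E_{\mathbf w\sim Q}\,\ell(\mathbf h_{\mathbf w}(\mathbf x),y)\,\Big|\,\ell(\mathbf h_{\mathbf p}(\mathbf x),y)=1\Big].$$ *)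

theory Defs
  imports "HOL-Probability.Probability"
begin

definition erf :: "real \<Rightarrow> real" where
  "erf k = 2 / sqrt pi * (LBINT t=0..k. exp (- (t\<^sup>2)))"

(* The upper tail of the standard normal distribution, not its CDF. *)
definition Phi :: "real \<Rightarrow> real" where
  "Phi k = 1 / 2 * (1 - erf (k / sqrt 2))"

definition std_gaussian_at :: "real ^ 'n \<Rightarrow> (real ^ 'n) measure" where
  "std_gaussian_at p = density lborel
     (\<lambda>w. ennreal ((2 * pi) powr (- real CARD('n) / 2) * exp (- (norm (w - p))\<^sup>2 / 2)))"

definition classifier_vec :: "('n \<Rightarrow> 'x \<Rightarrow> real) \<Rightarrow> 'x \<Rightarrow> real ^ 'n" where
  "classifier_vec f x = (\<chi> j. f j x)"

definition vote_argmax :: "('n::finite \<Rightarrow> 'x \<Rightarrow> real) \<Rightarrow> real ^ 'n \<Rightarrow> 'x \<Rightarrow> real set" where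
  "vote_argmax f w x =
     {l. is_arg_max (\<lambda>l. \<Sum>j\<in>UNIV. w $ j * of_bool (f j x = l)) (\<lambda>l. l \<in> {-1, 1}) l}"

(* In a tie both labels are maximisers, so the vote is wrong for either value of y. *)
definition vote_loss :: "('n::finite \<Rightarrow> 'x \<Rightarrow> real) \<Rightarrow> real ^ 'n \<Rightarrow> 'x \<Rightarrow> real \<Rightarrow> real" where
  "vote_loss f w x y = of_bool (vote_argmax f w x \<noteq> {y})"

definition expected_loss ::
    "('n::finite \<Rightarrow> 'x \<Rightarrow> real) \<Rightarrow> (real ^ 'n) measure \<Rightarrow> 'x \<Rightarrow> real \<Rightarrow> real" where
  "expected_loss f Q x y = (\<integral>w. vote_loss f w x y \<partial>Q)"

(* E[g | A] for an event A; meaningful only if A has positive probability. *)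
definition event_expectation :: "'a measure \<Rightarrow> ('a \<Rightarrow> real) \<Rightarrow> 'a set \<Rightarrow> real" where
  "event_expectation M g A = (\<integral>z. g z \<partial>uniform_measure M A)"

definition b_term ::
    "('x \<times> real) measure \<Rightarrow> ('n::finite \<Rightarrow> 'x \<Rightarrow> real) \<Rightarrow> (real ^ 'n) measure \<Rightarrow> real ^ 'n \<Rightarrow> real" where
  "b_term D f Q p = event_expectation D (\<lambda>(x, y). expected_loss f Q x y)
     {(x, y) \<in> space D. vote_loss f p x y = 0}"

definition c_term ::
    "('x \<times> real) measure \<Rightarrow> ('n::finite \<Rightarrow> 'x \<Rightarrow> real) \<Rightarrow> (real ^ 'n) measure \<Rightarrow> real ^ 'n \<Rightarrow> real" where
  "c_term D f Q p = event_expectation D (\<lambda>(x, y). expected_loss f Q x y)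
     {(x, y) \<in> space D. vote_loss f p x y = 1}"

end

(* Since y and the entries of f(x) are signs, the vote errs exactly when y (w . f(x)) <= 0, and
   y (w . f(x)) is a linear combination of independent normal coordinates, hence normal with mean
   y (p . f(x)) and standard deviation ||f(x)||. Its mass on the nonpositive half-line is the tail
   Phi of the quotient. Conditioning on an error (or on success) of h_p fixes the sign of
   y (p . f(x)), and Phi(-k) = 1 - Phi(k) then gives the two conditional formulas. *)
theory Submission
  imports Defs
begin

section \<open>The error function and the one-dimensional Gaussian tail\<close>

lemma integrable_exp_neg_square: "integrable lborel (\<lambda>x::real. exp (- x\<^sup>2))"
proof -
  \<comment> \<open>The integrand is \<open>sqrt pi\<close> times the normal density with variance
    1/2, so its integral is a zeroth normal moment.\<close>
  have "integrable lborel (\<lambda>x. sqrt pi * (normal_density 0 (1 / sqrt 2) x * (x - 0) ^ 0))"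
    by (intro integrable_mult_right integrable_normal_moment) simp
  then show ?thesis
    by (simp add: normal_density_def power_divide)
qed

lemma interval_integrable_exp_neg_square:
  "interval_lebesgue_integrable lborel a b (\<lambda>x::real. exp (- x\<^sup>2))"
proof -
  have "set_integrable lborel UNIV (\<lambda>x::real. exp (- x\<^sup>2))"
    by (simp add: set_integrable_def integrable_exp_neg_square)
  then show ?thesis
    by (auto simp: interval_lebesgue_integrable_def intro: set_integrable_subset)
qed

text \<open>A single point is null. This reconciles the open ray of interval integrals up to
  infinity with the closed ray coming from \<open>{..0}\<close>.\<close>

lemma set_lebesgue_integral_Ici_eq_Ioi:
  fixes f :: "real \<Rightarrow> real"
  shows "(LBINT x:{a..}. f x) = (LBINT x:{a<..}. f x)"
  by (intro set_integral_discrete_difference[where X = "{a}"]) auto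

text \<open>The half-line integral from 0 is \<open>sqrt pi / 2\<close>; splitting it at
  \<open>k\<close> leaves the tail. Interval integrals are signed, so negative \<open>k\<close> is
  covered as well.\<close>

lemma gaussian_tail:
  "(LBINT x:{k..}. exp (- x\<^sup>2)) = sqrt pi / 2 * (1 - erf k)"
proof -
  have "(LBINT x:{0..}. exp (- x\<^sup>2)) = sqrt pi / 2"
    using has_bochner_integral_integral_eq[OF gaussian_moment_0]
    by (simp add: set_lebesgue_integral_def)
  moreover have "(LBINT x=ereal 0..k. exp (- x\<^sup>2)) + (LBINT x=k..\<infinity>. exp (- x\<^sup>2)) = (LBINT x=ereal 0..\<infinity>. exp (- x\<^sup>2))"
    by (intro interval_integral_sum interval_integrable_exp_neg_square)
  ultimately show ?thesis
    unfolding erf_def interval_integral_to_infinity_eq set_lebesgue_integral_Ici_eq_Ioi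
    by (simp add: zero_ereal_def right_diff_distrib)
qed

lemma Phi_eq_integral:
  assumes \<sigma>: "\<sigma> > 0"
  shows "Phi (\<mu> / \<sigma>) = (\<integral>x. normal_density \<mu> \<sigma> x * indicator {..0} x \<partial>lborel)"
proof -
  \<comment> \<open>The substitution x = \<mu> - sqrt 2 \<sigma> t turns the exponent into -t^2. Its
    negative slope maps x \<le> 0 to the upper ray t \<ge> \<mu> / (\<sigma> sqrt 2), and the
    Jacobian cancels all of the normalising constant but 1 / sqrt pi.\<close>
  have c: "- sqrt 2 * \<sigma> \<noteq> 0" using \<sigma> by simp
  have "(\<integral>x. normal_density \<mu> \<sigma> x * indicator {..0} x \<partial>lborel)
      = sqrt 2 * \<sigma> * (\<integral>x. normal_density \<mu> \<sigma> (\<mu> + - sqrt 2 * \<sigma> * x) *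
          indicator {..0} (\<mu> + - sqrt 2 * \<sigma> * x) \<partial>lborel)"
    using \<sigma> by (subst lborel_integral_real_affine[OF c, of _ \<mu>]) (simp add: abs_mult)
  also have "(\<lambda>x. normal_density \<mu> \<sigma> (\<mu> + - sqrt 2 * \<sigma> * x) *
          indicator {..0} (\<mu> + - sqrt 2 * \<sigma> * x)) =
      (\<lambda>x. 1 / (sqrt 2 * \<sigma> * sqrt pi) *
        (indicator {\<mu> / \<sigma> / sqrt 2..} x *\<^sub>R exp (- x\<^sup>2)) :: real)"
    using \<sigma> by (auto simp: fun_eq_iff normal_density_def indicator_def power_mult_distrib
        field_simps real_sqrt_mult)
  also have "sqrt 2 * \<sigma> * (\<integral>x. 1 / (sqrt 2 * \<sigma> * sqrt pi) *
        (indicator {\<mu> / \<sigma> / sqrt 2..} x *\<^sub>R exp (- x\<^sup>2)) \<partial>lborel)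
      = 1 / sqrt pi * (LBINT x:{\<mu> / \<sigma> / sqrt 2..}. exp (- x\<^sup>2))"
    using \<sigma> unfolding set_lebesgue_integral_def by (subst integral_mult_right_zero) simp
  also have "\<dots> = Phi (\<mu> / \<sigma>)"
    by (simp add: gaussian_tail Phi_def)
  finally show ?thesis ..
qed

text \<open>The even integrand makes \<open>erf\<close> odd: reflecting the interval and then
  swapping its endpoints costs one sign.\<close>

lemma Phi_minus: "Phi (- k) = 1 - Phi k"
proof -
  have "(LBINT t=0..ereal (- a). exp (- t\<^sup>2)) = - (LBINT t=0..ereal a. exp (- t\<^sup>2))" for a :: real
    by (subst interval_integral_reflect, subst interval_integral_endpoints_reverse) simp
  then have "erf (- a) = - erf a" for a
    by (simp add: erf_def)
  then show ?thesis
    by (simp add: Phi_def field_simps)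
qed

lemma Phi_nonneg: "0 \<le> Phi k"
  using Phi_eq_integral[of 1 k] by simp

lemma Phi_le_1: "Phi k \<le> 1"
  using Phi_nonneg[of "- k"] by (simp add: Phi_minus)

text \<open>With \<sigma> = 1, \<open>Phi\<close> is a parameter integral of a jointly measurable
  function, hence measurable in the parameter.\<close>

lemma borel_measurable_Phi [measurable]: "Phi \<in> borel_measurable borel"
proof -
  have "Phi = (\<lambda>k. \<integral>x. normal_density k 1 x * indicator {..0} x \<partial>lborel)"
    using Phi_eq_integral[of 1] by (simp add: fun_eq_iff)
  also have "\<dots> \<in> borel_measurable borel"
    unfolding normal_density_def by measurable
  finally show ?thesis .
qed

section \<open>The standard Gaussian on vectors: product form, marginals, independence\<close>

lemma prod_Basis_vec:
  "(\<Prod>b\<in>Basis. h (b :: real ^ 'n)) = (\<Prod>i\<in>(UNIV :: 'n::finite set). h (axis i 1))"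
proof -
  have Basis: "Basis = range (\<lambda>i. axis i 1 :: real ^ 'n)"
    by (auto simp: Basis_vec_def)
  have inj: "inj (\<lambda>i. axis i 1 :: real ^ 'n)"
    by (auto simp: inj_on_def axis_eq_axis)
  show ?thesis
    unfolding Basis prod.reindex[OF inj] o_def ..
qed

lemma nn_integral_lborel_vec_prod:
  fixes h :: "'n::finite \<Rightarrow> real \<Rightarrow> ennreal"
  assumes [measurable]: "\<And>i. h i \<in> borel_measurable borel"
  shows "(\<integral>\<^sup>+w. (\<Prod>i\<in>UNIV. h i (w $ i)) \<partial>lborel) = (\<Prod>i\<in>UNIV. \<integral>\<^sup>+t. h i t \<partial>lborel)"
proof -
  \<comment> \<open>The product rule for \<open>lborel\<close> runs over basis vectors;
    \<open>idx\<close> recovers the coordinate of each, as \<open>axis\<close> is injective in its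
    index.\<close>
  define idx where "idx b = (SOME i. b = axis i 1)" for b :: "real ^ 'n"
  have idx: "idx (axis i 1) = i" for i
    unfolding idx_def by (simp add: axis_eq_axis)
  have "(\<integral>\<^sup>+w. (\<Prod>b\<in>Basis. h (idx b) (w \<bullet> b)) \<partial>lborel) = (\<Prod>b\<in>Basis. \<integral>\<^sup>+t. h (idx b) t \<partial>lborel)"
    by (rule nn_integral_lborel_prod) auto
  then show ?thesis
    by (simp add: prod_Basis_vec idx inner_axis)
qed

text \<open>The squared norm is a sum over coordinates, so the exponential factors, and the constant
  is the CARD('n)-th power of the one-dimensional one.\<close>

lemma std_gaussian_density_eq_prod:
  fixes p w :: "real ^ 'n"
  shows "(2 * pi) powr (- real CARD('n) / 2) * exp (- (norm (w - p))\<^sup>2 / 2)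
      = (\<Prod>i\<in>UNIV. normal_density (p $ i) 1 (w $ i))"
proof -
  have "exp (- (norm (w - p))\<^sup>2 / 2) = (\<Prod>i\<in>UNIV. exp (- (w $ i - p $ i)\<^sup>2 / 2))"
    by (simp add: norm_vec_def L2_set_def sum_nonneg exp_sum[symmetric] sum_negf
        sum_divide_distrib)
  moreover have "(2 * pi) powr (- real CARD('n) / 2) = (1 / sqrt (2 * pi)) ^ CARD('n)"
    by (simp add: powr_half_sqrt[symmetric] powr_power powr_minus_divide power_one_over)
  ultimately show ?thesis
    by (simp add: normal_density_def prod.distrib prod_dividef power_one_over)
qed

lemma space_std_gaussian_at [simp]: "space (std_gaussian_at p) = UNIV"
  and sets_std_gaussian_at [simp, measurable_cong]: "sets (std_gaussian_at p) = sets borel"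
  by (simp_all add: std_gaussian_at_def)

text \<open>Density and box indicator both factor over coordinates. Total mass, marginals and
  independence are all read off from this formula.\<close>

lemma emeasure_std_gaussian_at_box:
  fixes p :: "real ^ 'n"
  assumes [measurable]: "\<And>i. A i \<in> sets borel"
  shows "emeasure (std_gaussian_at p) {w. \<forall>i. w $ i \<in> A i}
      = (\<Prod>i\<in>UNIV. emeasure (density lborel (normal_density (p $ i) 1)) (A i))"
proof -
  have ind: "indicator {w. \<forall>i. w $ i \<in> A i} w = (\<Prod>i\<in>UNIV. indicator (A i) (w $ i) :: ennreal)" for w
    by (auto simp: indicator_def prod_eq_1_iff intro: prod_zero)
  have "emeasure (std_gaussian_at p) {w. \<forall>i. w $ i \<in> A i}
      = (\<integral>\<^sup>+w. (\<Prod>i\<in>UNIV. ennreal (normal_density (p $ i) 1 (w $ i)) * indicator (A i) (w $ i)) \<partial>lborel)"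
    unfolding std_gaussian_at_def std_gaussian_density_eq_prod
    by (subst emeasure_density) (auto simp: ind prod_ennreal prod.distrib)
  also have "\<dots> = (\<Prod>i\<in>UNIV. \<integral>\<^sup>+t. ennreal (normal_density (p $ i) 1 t) * indicator (A i) t \<partial>lborel)"
    by (rule nn_integral_lborel_vec_prod) simp
  also have "\<dots> = (\<Prod>i\<in>UNIV. emeasure (density lborel (normal_density (p $ i) 1)) (A i))"
    by (simp add: emeasure_density)
  finally show ?thesis .
qed

lemma emeasure_normal_UNIV: "\<sigma> > 0 \<Longrightarrow> emeasure (density lborel (normal_density \<mu> \<sigma>)) UNIV = 1"
  using prob_space.emeasure_space_1[OF prob_space_normal_density[of \<sigma> \<mu>]] by simp

lemma prob_space_std_gaussian_at: "prob_space (std_gaussian_at p)"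
  using emeasure_std_gaussian_at_box[of "\<lambda>_. UNIV" p]
  by (intro prob_spaceI) (simp add: emeasure_normal_UNIV)

lemma distr_std_gaussian_at_nth:
  "distr (std_gaussian_at p) borel (\<lambda>w. w $ i) = density lborel (normal_density (p $ i) 1)"
proof (rule measure_eqI)
  fix B assume "B \<in> sets (distr (std_gaussian_at p) borel (\<lambda>w. w $ i))"
  then have B [measurable]: "B \<in> sets borel" by simp
  have "emeasure (distr (std_gaussian_at p) borel (\<lambda>w. w $ i)) B
      = emeasure (std_gaussian_at p) {w. \<forall>j. w $ j \<in> (if j = i then B else UNIV)}"
    by (subst emeasure_distr) (auto intro!: arg_cong[where f = "emeasure _"] split: if_splits)
  also have "\<dots> = (\<Prod>j\<in>UNIV. if j = i then emeasure (density lborel (normal_density (p $ i) 1)) B else 1)"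
    by (subst emeasure_std_gaussian_at_box, simp, rule prod.cong)
      (simp_all add: emeasure_normal_UNIV)
  also have "\<dots> = emeasure (density lborel (normal_density (p $ i) 1)) B"
    by simp
  finally show "emeasure (distr (std_gaussian_at p) borel (\<lambda>w. w $ i)) B =
      emeasure (density lborel (normal_density (p $ i) 1)) B" .
qed simp

lemma indep_vars_std_gaussian_at:
  fixes p :: "real ^ 'n"
  shows "prob_space.indep_vars (std_gaussian_at p) (\<lambda>_. borel) (\<lambda>i w. w $ i) (UNIV :: 'n set)"
proof -
  interpret prob_space "std_gaussian_at p" by (rule prob_space_std_gaussian_at)
  interpret N: prob_space "density lborel (normal_density (p $ i) 1)" for i
    by (rule prob_space_normal_density) simp
  interpret P: product_prob_space "\<lambda>i. density lborel (normal_density (p $ i) 1)" UNIV ..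
  \<comment> \<open>Independence amounts to the joint law being the product of the marginals, and a
    finite product measure is determined by its values on boxes.\<close>
  have "distr (std_gaussian_at p) (\<Pi>\<^sub>M i\<in>UNIV. borel) (\<lambda>x. \<lambda>i\<in>UNIV. x $ i)
      = (\<Pi>\<^sub>M i\<in>UNIV. density lborel (normal_density (p $ i) 1))"
  proof (rule P.PiM_eqI)
    fix A :: "'n \<Rightarrow> real set"
    assume "\<And>i. i \<in> UNIV \<Longrightarrow> A i \<in> sets (density lborel (normal_density (p $ i) 1))"
    then have A [measurable]: "\<And>i. A i \<in> sets borel" by simp
    have "emeasure (distr (std_gaussian_at p) (\<Pi>\<^sub>M i\<in>UNIV. borel) (\<lambda>x. \<lambda>i\<in>UNIV. x $ i)) (Pi\<^sub>E UNIV A)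
        = emeasure (std_gaussian_at p) {w. \<forall>i. w $ i \<in> A i}"
      by (subst emeasure_distr)
        (auto intro!: arg_cong[where f = "emeasure _"] sets_PiM_I_finite measurable_restrict)
    then show "emeasure (distr (std_gaussian_at p) (\<Pi>\<^sub>M i\<in>UNIV. borel) (\<lambda>x. \<lambda>i\<in>UNIV. x $ i)) (Pi\<^sub>E UNIV A)
        = (\<Prod>i\<in>UNIV. emeasure (density lborel (normal_density (p $ i) 1)) (A i))"
      by (simp add: emeasure_std_gaussian_at_box)
  qed (auto intro!: sets_PiM_cong)
  then show ?thesis
    by (subst indep_vars_iff_distr_eq_PiM') (simp_all add: distr_std_gaussian_at_nth)
qed

text \<open>Independent normals add, with means and variances summing. Nonzero entries of
  \<open>a\<close> keep the standard deviation of each summand positive, so that it has a normal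
  density.\<close>

lemma distributed_std_gaussian_at_inner:
  fixes p a :: "real ^ 'n"
  assumes a: "\<And>i. a $ i \<noteq> 0"
  shows "distributed (std_gaussian_at p) lborel (\<lambda>w. w \<bullet> a) (normal_density (p \<bullet> a) (norm a))"
proof -
  interpret prob_space "std_gaussian_at p" by (rule prob_space_std_gaussian_at)
  have "distributed (std_gaussian_at p) lborel (\<lambda>w. \<Sum>i\<in>UNIV. w $ i * a $ i)
     (normal_density (\<Sum>i\<in>UNIV. p $ i * a $ i) (sqrt (\<Sum>i\<in>UNIV. \<bar>a $ i\<bar>\<^sup>2)))"
  proof (rule sum_indep_normal)
    show "indep_vars (\<lambda>i. borel) (\<lambda>i w. w $ i * a $ i) UNIV"
      by (rule indep_vars_compose2[OF indep_vars_std_gaussian_at]) simp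
    show "distributed (std_gaussian_at p) lborel (\<lambda>w. w $ i * a $ i)
        (normal_density (p $ i * a $ i) \<bar>a $ i\<bar>)" for i
    proof -
      have "distributed (std_gaussian_at p) lborel (\<lambda>w. w $ i) (normal_density (p $ i) 1)"
        unfolding distributed_def
        using distr_std_gaussian_at_nth[of p i] by (simp cong: distr_cong)
      from normal_density_affine[OF this, of "a $ i" 0] show ?thesis
        using a by (simp add: mult.commute)
    qed
  qed (use a in auto)
  then show ?thesis
    by (simp add: inner_vec_def norm_vec_def L2_set_def)
qed

section \<open>The loss of the weighted vote and its Gaussian average\<close>

lemma vote_loss_eq:
  assumes f: "\<And>j. f j x \<in> {-1, 1}" and y: "y \<in> {-1, 1}"
  shows "vote_loss f w x y = of_bool (y * (w \<bullet> classifier_vec f x) \<le> 0)"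
proof -
  define S where "S l = (\<Sum>j\<in>UNIV. w $ j * of_bool (f j x = l))" for l
  \<comment> \<open>Each \<open>f j x\<close> is a sign, so it equals the indicator of 1 minus the
    indicator of -1.\<close>
  have diff: "S 1 - S (-1) = w \<bullet> classifier_vec f x"
    unfolding S_def classifier_vec_def inner_vec_def sum_subtractf[symmetric]
  proof (rule sum.cong)
    fix j show "w $ j * of_bool (f j x = 1) - w $ j * of_bool (f j x = -1) = w $ j \<bullet> (\<chi> j. f j x) $ j"
      using f[of j] by auto
  qed simp
  have "vote_argmax f w x = {l \<in> {-1, 1}. S (-1) \<le> S l \<and> S 1 \<le> S l}"
    by (auto simp: vote_argmax_def is_arg_max_def S_def not_less)
  also have "\<dots> = (if S 1 < S (-1) then {-1} else if S (-1) < S 1 then {1} else {-1, 1})"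
    by auto
  \<comment> \<open>A tie gives the maximiser set {-1, 1}, which is never \<open>{y}\<close>, while
    the product is 0; hence ties belong to the non-strict inequality.\<close>
  finally have "vote_argmax f w x \<noteq> {y} \<longleftrightarrow> y * (S 1 - S (-1)) \<le> 0"
    using y by (elim insertE) (simp_all add: doubleton_eq_iff)
  then show ?thesis
    by (simp only: vote_loss_def diff)
qed

lemma expected_loss_std_gaussian_at:
  fixes p :: "real ^ 'n"
  assumes f: "\<And>j. f j x \<in> {-1, 1}" and y: "y \<in> {-1, 1}"
  shows "expected_loss f (std_gaussian_at p) x y
      = Phi (y * ((p \<bullet> classifier_vec f x) / norm (classifier_vec f x)))"
proof -
  \<comment> \<open>Absorbing the sign \<open>y\<close> into the vector keeps its norm and its
    nonzero entries, and the error event becomes \<open>w \<bullet> a \<le> 0\<close>.\<close>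
  define a where "a = y *\<^sub>R classifier_vec f x"
  have nz: "a $ i \<noteq> 0" for i
    using f[of i] y by (auto simp: a_def classifier_vec_def)
  \<comment> \<open>The index type is nonempty, so some coordinate witnesses this; the standard
    deviation \<open>norm a\<close> is therefore positive.\<close>
  then have "a \<noteq> 0" by (metis zero_index)
  have norm_a: "norm a = norm (classifier_vec f x)"
    using y by (auto simp: a_def)
  have "expected_loss f (std_gaussian_at p) x y = (\<integral>w. indicator {..0} (w \<bullet> a) \<partial>std_gaussian_at p)"
    using y unfolding expected_loss_def
    by (auto simp: vote_loss_eq[of f x y, OF f y] a_def indicator_def of_bool_def)
  also have "\<dots> = (\<integral>t. normal_density (p \<bullet> a) (norm a) t * indicator {..0} t \<partial>lborel)"
    by (rule distributed_integral[OF distributed_std_gaussian_at_inner, symmetric]) (auto simp: nz)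
  also have "\<dots> = Phi ((p \<bullet> a) / norm a)"
    using \<open>a \<noteq> 0\<close> by (simp add: Phi_eq_integral)
  finally show ?thesis
    by (simp add: norm_a) (simp add: a_def)
qed

section \<open>Conditional expectations given error or success\<close>

lemma event_expectation_cong:
  assumes "A \<in> sets M" "\<And>z. z \<in> A \<Longrightarrow> g z = h z"
    and [measurable]: "g \<in> borel_measurable M" "h \<in> borel_measurable M"
  shows "event_expectation M g A = event_expectation M h A"
  \<comment> \<open>The conditional measure is concentrated on \<open>A\<close>, so agreement on
    \<open>A\<close> is agreement almost everywhere.\<close>
  unfolding event_expectation_def
  using assms by (intro integral_cong_AE AE_uniform_measureI) auto

theorem proposition6:
  fixes X :: "'x measure"
    and D :: "('x \<times> real) measure"
    and f :: "'n::finite \<Rightarrow> 'x \<Rightarrow> real"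
    and p :: "real ^ 'n"
  assumes "\<And>j. f j \<in> measurable X (count_space {-1, 1})"
    and "prob_space D"
    and "sets D = sets (X \<Otimes>\<^sub>M count_space {-1, 1})"
  shows "(\<forall>x\<in>space X. \<forall>y\<in>{-1, 1}.
            expected_loss f (std_gaussian_at p) x y
              = Phi (y * ((p \<bullet> classifier_vec f x) / norm (classifier_vec f x))))
       \<and> (measure D {(x, y) \<in> space D. y * (p \<bullet> classifier_vec f x) \<le> 0} > 0 \<longrightarrow>
            c_term D f (std_gaussian_at p) p
              = 1 - event_expectation D
                      (\<lambda>(x, y). Phi (\<bar>p \<bullet> classifier_vec f x\<bar> / norm (classifier_vec f x)))
                      {(x, y) \<in> space D. y * (p \<bullet> classifier_vec f x) \<le> 0})
       \<and> (measure D {(x, y) \<in> space D. y * (p \<bullet> classifier_vec f x) > 0} > 0 \<longrightarrow>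
            b_term D f (std_gaussian_at p) p
              = event_expectation D
                  (\<lambda>(x, y). Phi (\<bar>p \<bullet> classifier_vec f x\<bar> / norm (classifier_vec f x)))
                  {(x, y) \<in> space D. y * (p \<bullet> classifier_vec f x) > 0})"
proof -
  interpret D: prob_space D by fact
  let ?v = "\<lambda>x. p \<bullet> classifier_vec f x"
  let ?g = "\<lambda>(x, y). Phi (\<bar>?v x\<bar> / norm (classifier_vec f x))"
  let ?E = "\<lambda>(x, y). expected_loss f (std_gaussian_at p) x y"
  let ?C = "{(x, y) \<in> space D. y * ?v x \<le> 0}"
  let ?B = "{(x, y) \<in> space D. y * ?v x > 0}"
  note [measurable_cong] = assms(3)
  have f: "f j x \<in> {-1, 1}" if "x \<in> space X" for j x
    using measurable_space[OF assms(1) that] by simp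
  \<comment> \<open>Every point of \<open>D\<close> carries a genuine sign label, so the pointwise
    formulas apply on the whole space.\<close>
  have space_D: "space D = space X \<times> {-1, 1}"
    using sets_eq_imp_space_eq[OF assms(3)] by (simp add: space_pair_measure)
  have [measurable]: "f j \<in> borel_measurable X" for j
    using measurable_compose[OF assms(1), of "\<lambda>x. x" borel] by simp
  have [measurable]: "classifier_vec f \<in> borel_measurable X"
    unfolding classifier_vec_def by (rule borel_measurable_euclidean_space[THEN iffD2])
      (auto simp: Basis_vec_def inner_axis)
  have [measurable]: "snd \<in> borel_measurable D"
    using measurable_compose[OF measurable_snd, of "\<lambda>x. x" "count_space {-1, 1::real}" borel X]
    by (simp cong: measurable_cong_sets add: assms(3))
  have [measurable]: "fst \<in> measurable D X"
    by measurable
  have exp_loss: "expected_loss f (std_gaussian_at p) x y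
      = Phi (y * (?v x / norm (classifier_vec f x)))" if "x \<in> space X" "y \<in> {-1, 1}" for x y
    using f that by (intro expected_loss_std_gaussian_at) auto
  have loss: "vote_loss f p x y = of_bool (y * ?v x \<le> 0)" if "x \<in> space X" "y \<in> {-1, 1}" for x y
    using f that by (intro vote_loss_eq) auto
  have E: "expected_loss f (std_gaussian_at p) (fst z) (snd z)
      = Phi (snd z * ?v (fst z) / norm (classifier_vec f (fst z)))" if "z \<in> space D" for z
    using that by (auto simp: space_D exp_loss)
  \<comment> \<open>Measurability of the expected loss comes from its closed form on
    \<open>space D\<close>.\<close>
  have [measurable]: "?E \<in> borel_measurable D"
    unfolding case_prod_beta by (subst measurable_cong[OF E]) measurable
  have [measurable]: "?g \<in> borel_measurable D"
    unfolding case_prod_beta by measurable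
  have "?C = {z \<in> space D. snd z * ?v (fst z) \<le> 0}" "?B = {z \<in> space D. snd z * ?v (fst z) > 0}"
    by auto
  moreover have "{z \<in> space D. snd z * ?v (fst z) \<le> 0} \<in> sets D"
    "{z \<in> space D. snd z * ?v (fst z) > 0} \<in> sets D"
    by measurable
  ultimately have [measurable]: "?C \<in> sets D" "?B \<in> sets D"
    by simp_all
  have "c_term D f (std_gaussian_at p) p = 1 - event_expectation D ?g ?C" if "measure D ?C > 0"
  proof -
    \<comment> \<open>Positive probability of the event makes the conditional measure a probability
      measure, so the constant 1 integrates to 1 below.\<close>
    interpret U: prob_space "uniform_measure D ?C"
      using that by (intro prob_space_uniform_measure) (auto simp: D.emeasure_eq_measure)
    have "{(x, y) \<in> space D. vote_loss f p x y = 1} = ?C"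
      by (auto simp: space_D loss)
    then have "c_term D f (std_gaussian_at p) p = event_expectation D ?E ?C"
      by (simp add: c_term_def)
    also have "\<dots> = event_expectation D (\<lambda>z. 1 - ?g z) ?C"
    proof (rule event_expectation_cong)
      fix z assume z: "z \<in> ?C"
      \<comment> \<open>As \<open>y\<close> is a sign, y v \<le> 0 forces y v = -|v|;
        \<open>Phi_minus\<close> then produces the 1 - \<open>Phi\<close> form.\<close>
      then have "snd z * ?v (fst z) = - \<bar>?v (fst z)\<bar>"
        by (auto simp: space_D)
      with z show "?E z = 1 - ?g z"
        by (auto simp: E case_prod_beta Phi_minus[symmetric])
    qed measurable
    also have "\<dots> = 1 - event_expectation D ?g ?C"
    proof -
      \<comment> \<open>\<open>Phi\<close> takes values between 0 and 1, and this boundedness lets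
        the integral of the difference split.\<close>
      have "integrable (uniform_measure D ?C) ?g"
        by (rule U.integrable_const_bound[where B = 1])
          (auto simp: Phi_nonneg Phi_le_1 case_prod_beta)
      then show ?thesis
        unfolding event_expectation_def
        by (subst Bochner_Integration.integral_diff) (auto simp: U.prob_space[simplified])
    qed
    finally show ?thesis .
  qed
  moreover have "b_term D f (std_gaussian_at p) p = event_expectation D ?g ?B"
  proof -
    have "{(x, y) \<in> space D. vote_loss f p x y = 0} = ?B"
      by (auto simp: space_D loss)
    then have "b_term D f (std_gaussian_at p) p = event_expectation D ?E ?B"
      by (simp add: b_term_def)
    also have "\<dots> = event_expectation D ?g ?B"
    proof (rule event_expectation_cong)
      fix z assume z: "z \<in> ?B"
      \<comment> \<open>Here y v > 0 gives y v = |v|, so no reflection of \<open>Phi\<close>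
        occurs.\<close>
      then have "snd z * ?v (fst z) = \<bar>?v (fst z)\<bar>"
        by (auto simp: space_D)
      with z show "?E z = ?g z"
        by (auto simp: E case_prod_beta)
    qed measurable
    finally show ?thesis .
  qed
  ultimately show ?thesis
    using exp_loss by blast
qed

end
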